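(* Let $f_i\in\mathcal{C}^1(\mathbb{R}^n)$, $1\le i\le m$, be exponentially smooth with constants $L_i>0$. Let $\alpha_i\ge0$ be such that $\sum_{i=1}^m\alpha_i>0$. Then $\sum_{i=1}^m\alpha_if_i$ is exponentially smooth with constant $L:=\max_{1\le i\le m}L_i$. In particular, for every $L>0$ the set $\{f\in\mathcal{C}^1(\mathbb{R}^n): f\text{ is exponentially smooth with constant }L\}$ is a convex cone (closed under addition and under multiplication by positive scalars).
   Context: Let $\operatorname{SumExp}(x)=\sum_{j=1}^n\exp(x_j)$ on $\mathbb{R}^n$, and for $\lambda>0$ let $(\lambda\star h)(x)=\lambda h(\lambda^{-1}x)$. Write $\operatorname{Log}(v)=(\ln v_j)_{j=1}^n$ for $v\in\mathbb{R}^n_{++}=(0,\infty)^n$; this is the inverse of $\nabla\operatorname{SumExp}$, whose range is $\mathbb{R}^n_{++}$. A function $f\in\mathcal{C}^1(\mathbb{R}^n)$ is exponentially smooth with constant $L>0$ if it is anisotropically smooth relative to $\phi=\operatorname{SumExp}$ with constant $L$, i.e., $\nabla f(x)\in\mathbb{R}^n_{++}$ for all $x$, and for all $\bar x,x\in\mathbb{R}^n$ $$f(x)\le f(\bar x)+\tfrac1L\star\operatorname{SumExp}\big(x-\bar x+L^{-1}\operatorname{Log}(\nabla f(\bar x))\big)-\tfrac1L\star\operatorname{SumExp}\big(L^{-1}\operatorname{Log}(\nabla f(\bar x))\big).$$ *)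

theory Defs
  imports "HOL-Analysis.Analysis"
begin

definition gradient :: "(real^'n \<Rightarrow> real) \<Rightarrow> real^'n \<Rightarrow> real^'n" where
  "gradient f x = (THE D. GDERIV f x :> D)"

definition C1_fun :: "(real^'n \<Rightarrow> real) \<Rightarrow> bool" where
  "C1_fun f \<longleftrightarrow> (\<forall>x. f differentiable (at x)) \<and> continuous_on UNIV (gradient f)"

definition SumExp :: "real^'n \<Rightarrow> real" where
  "SumExp x = (\<Sum>j\<in>UNIV. exp (x $ j))"

definition Log :: "real^'n \<Rightarrow> real^'n" where
  "Log v = (\<chi> j. ln (v $ j))"

definition epi_scale :: "real \<Rightarrow> (real^'n \<Rightarrow> real) \<Rightarrow> real^'n \<Rightarrow> real" (infixr \<open>\<star>\<close> 75) where
  "(l \<star> h) x = l * h (inverse l *\<^sub>R x)"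

definition exponentially_smooth :: "real \<Rightarrow> (real^'n \<Rightarrow> real) \<Rightarrow> bool" where
  "exponentially_smooth L f \<longleftrightarrow>
     L > 0 \<and> C1_fun f \<and>
     (\<forall>x j. gradient f x $ j > 0) \<and>
     (\<forall>xbar x. f x \<le> f xbar
        + ((1 / L) \<star> SumExp) (x - xbar + inverse L *\<^sub>R Log (gradient f xbar))
        - ((1 / L) \<star> SumExp) (inverse L *\<^sub>R Log (gradient f xbar)))"

(* Function types carry no real_vector structure in HOL-Analysis, so the library notions
   cone and convex do not apply; the operations below are pointwise, and only
   positive scalars are used (the zero function need not belong to the cone). *)
definition convex_cone_of_functions :: "('a \<Rightarrow> real) set \<Rightarrow> bool" where
  "convex_cone_of_functions S \<longleftrightarrow>
     (\<forall>f\<in>S. \<forall>g\<in>S. (\<lambda>x. f x + g x) \<in> S) \<and>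
     (\<forall>c>0. \<forall>f\<in>S. (\<lambda>x. c * f x) \<in> S)"

lemma gradient_eqI:
  assumes "GDERIV f x :> D"
  shows "gradient f x = D"
  unfolding gradient_def
proof (rule the_equality[where a = D])
  fix E assume "GDERIV f x :> E"
  then have "(\<lambda>h. h \<bullet> E) = (\<lambda>h. h \<bullet> D)"
    using has_derivative_unique[of f _ x] assms unfolding gderiv_def by simp
  then show "E = D"
    using vector_eq_ldot[of E D] unfolding fun_eq_iff by blast
qed (rule assms)

lemma gradient_SumExp: "gradient SumExp x = (\<chi> j. exp (x $ j))"
proof (rule gradient_eqI)
  have "((\<lambda>y. exp (y $ j)) has_derivative (\<lambda>h. exp (x $ j) * h $ j)) (at x)" for j
    using has_derivative_exp[OF bounded_linear_imp_has_derivative[OF bounded_linear_vec_nth]]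
    by (subst mult.commute)
  then have "(SumExp has_derivative (\<lambda>h. \<Sum>j\<in>UNIV. exp (x $ j) * h $ j)) (at x)"
    unfolding SumExp_def[abs_def] by (intro has_derivative_sum)
  then show "GDERIV SumExp x :> (\<chi> j. exp (x $ j))"
    by (simp add: gderiv_def inner_vec_def mult.commute)
qed

lemma Log_gradient_SumExp: "Log (gradient SumExp x) = x"
  by (simp add: gradient_SumExp Log_def vec_eq_iff)

lemma gradient_SumExp_Log: "(\<forall>j. v $ j > 0) \<Longrightarrow> gradient SumExp (Log v) = v"
  by (simp add: gradient_SumExp Log_def vec_eq_iff)

end

theory Submission imports Defs begin

text \<open>
  Scaling and the logarithm cancel. If \<open>g = \<nabla>f(x\<^sub>0)\<close> is positive and
  \<open>d = x - x\<^sub>0\<close>, then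
  \<open>(1/L \<star> SumExp)(d + Log g / L) = \<Sum>\<^sub>j g\<^sub>j exp (L d\<^sub>j) / L\<close>, so that the
  upper bound that defines exponential smoothness is
    \<open>f(x) \<le> f(x\<^sub>0) + \<Sum>\<^sub>j g\<^sub>j (exp (L d\<^sub>j) - 1) / L\<close>
  (\<open>exponentially_smooth_iff\<close>).
  For fixed \<open>L\<close> this is linear in the pair \<open>(f, \<nabla>f)\<close>, hence it survives nonnegative
  combinations; one positive weight keeps the gradient of the combination positive
  (\<open>exponentially_smooth_sum\<close>).
  For fixed \<open>t\<close> the quotient \<open>(exp (L t) - 1) / L\<close> is a chord slope of the convex function
  \<open>s \<mapsto> exp (s t)\<close> and therefore nondecreasing in \<open>L\<close>, so all constants may be raised
  to their maximum (\<open>exponentially_smooth_mono\<close>). The cone property is the case of equal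
  constants.
\<close>

text \<open>Every derivative of a real-valued function is an inner product with a vector (Riesz); the
  vector is the adjoint of the derivative applied to \<open>1\<close>.\<close>

lemma gderiv_gradient:
  fixes f :: "real^'n \<Rightarrow> real"
  assumes "f differentiable (at x)"
  shows "GDERIV f x :> gradient f x"
proof -
  obtain f' where f': "(f has_derivative f') (at x)"
    using assms by (auto simp: differentiable_def)
  have "h \<bullet> adjoint f' 1 = f' h" for h
    using adjoint_works[OF has_derivative_linear[OF f'], of h 1] by simp
  then have "GDERIV f x :> adjoint f' 1"
    using f' by (simp add: gderiv_def)
  then show ?thesis
    using gradient_eqI by metis
qed

lemma gderiv_sum_scale:
  fixes f :: "'i \<Rightarrow> real^'n \<Rightarrow> real"
  assumes "\<And>i. i \<in> I \<Longrightarrow> f i differentiable (at x)"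
  shows "GDERIV (\<lambda>y. \<Sum>i\<in>I. \<alpha> i * f i y) x :> (\<Sum>i\<in>I. \<alpha> i *\<^sub>R gradient (f i) x)"
proof -
  have "((\<lambda>y. \<Sum>i\<in>I. \<alpha> i * f i y) has_derivative
         (\<lambda>h. \<Sum>i\<in>I. \<alpha> i * (h \<bullet> gradient (f i) x))) (at x)"
    using gderiv_gradient[OF assms] unfolding gderiv_def
    by (intro has_derivative_sum has_derivative_mult_right) auto
  then show ?thesis
    by (simp add: gderiv_def inner_sum_right)
qed

lemma C1_fun_sum_scale:
  fixes f :: "'i \<Rightarrow> real^'n \<Rightarrow> real"
  assumes "\<And>i. i \<in> I \<Longrightarrow> C1_fun (f i)"
  shows "C1_fun (\<lambda>x. \<Sum>i\<in>I. \<alpha> i * f i x)"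
    and "gradient (\<lambda>x. \<Sum>i\<in>I. \<alpha> i * f i x) = (\<lambda>x. \<Sum>i\<in>I. \<alpha> i *\<^sub>R gradient (f i) x)"
proof -
  have D: "GDERIV (\<lambda>y. \<Sum>i\<in>I. \<alpha> i * f i y) x :> (\<Sum>i\<in>I. \<alpha> i *\<^sub>R gradient (f i) x)" for x
    using assms by (intro gderiv_sum_scale) (auto simp: C1_fun_def)
  show grad: "gradient (\<lambda>x. \<Sum>i\<in>I. \<alpha> i * f i x) = (\<lambda>x. \<Sum>i\<in>I. \<alpha> i *\<^sub>R gradient (f i) x)"
    using gradient_eqI[OF D] by blast
  show "C1_fun (\<lambda>x. \<Sum>i\<in>I. \<alpha> i * f i x)"
    unfolding C1_fun_def grad
  proof (intro conjI allI)
    show "(\<lambda>y. \<Sum>i\<in>I. \<alpha> i * f i y) differentiable (at x)" for x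
      using D[of x] unfolding gderiv_def differentiable_def by blast
    show "continuous_on UNIV (\<lambda>x. \<Sum>i\<in>I. \<alpha> i *\<^sub>R gradient (f i) x)"
      using assms by (intro continuous_intros) (auto simp: C1_fun_def)
  qed
qed

text \<open>Since \<open>exp (L (d\<^sub>j + ln g\<^sub>j / L)) = g\<^sub>j exp (L d\<^sub>j)\<close>, the gradient enters the bound
  linearly, although the definition passes it through a logarithm.\<close>

lemma epi_scale_SumExp_shift_Log:
  fixes d g :: "real^'n"
  assumes "L > 0" "\<And>j. g $ j > 0"
  shows "((1 / L) \<star> SumExp) (d + inverse L *\<^sub>R Log g) = (\<Sum>j\<in>UNIV. g $ j * exp (L * d $ j) / L)"
proof -
  have "exp (L * (d $ j + inverse L * ln (g $ j))) = g $ j * exp (L * d $ j)" for j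
  proof -
    have "L * (d $ j + inverse L * ln (g $ j)) = ln (g $ j) + L * d $ j"
      using assms(1) by (simp add: field_simps)
    then show ?thesis
      using assms(2)[of j] by (simp add: exp_add)
  qed
  then show ?thesis
    by (simp add: epi_scale_def SumExp_def Log_def sum_divide_distrib)
qed

lemma exponentially_smooth_iff:
  "exponentially_smooth L f \<longleftrightarrow>
     L > 0 \<and> C1_fun f \<and> (\<forall>x j. gradient f x $ j > 0) \<and>
     (\<forall>xbar x. f x \<le> f xbar
        + (\<Sum>j\<in>UNIV. gradient f xbar $ j * ((exp (L * (x - xbar) $ j) - 1) / L)))"
proof -
  have "((1 / L) \<star> SumExp) (x - xbar + inverse L *\<^sub>R Log (gradient f xbar))
        - ((1 / L) \<star> SumExp) (inverse L *\<^sub>R Log (gradient f xbar))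
      = (\<Sum>j\<in>UNIV. gradient f xbar $ j * ((exp (L * (x - xbar) $ j) - 1) / L))"
    if "L > 0" "\<And>x j. gradient f x $ j > 0" for x xbar
    using epi_scale_SumExp_shift_Log[OF that, of "x - xbar" xbar]
      epi_scale_SumExp_shift_Log[OF that, of 0 xbar]
    by (simp add: diff_divide_distrib right_diff_distrib sum_subtractf)
  then show ?thesis
    unfolding exponentially_smooth_def add_diff_eq[symmetric] by (intro conj_cong refl) simp
qed

lemma exp_chord_slope_mono:
  fixes L M t :: real
  assumes "0 < L" "L \<le> M"
  shows "(exp (L * t) - 1) / L \<le> (exp (M * t) - 1) / M"
proof -
  \<comment> \<open>\<open>L t\<close> is the convex combination of \<open>0\<close> and \<open>M t\<close> with weight \<open>L / M\<close> on \<open>M t\<close>.\<close>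
  have "exp ((1 - L / M) *\<^sub>R 0 + (L / M) *\<^sub>R (M * t))
      \<le> (1 - L / M) * exp 0 + (L / M) * exp (M * t)"
    using assms by (intro convex_onD[OF exp_convex]) auto
  then have "exp (L * t) - 1 \<le> L * ((exp (M * t) - 1) / M)"
    using assms by (simp add: diff_divide_distrib right_diff_distrib)
  then show ?thesis
    using assms by (simp add: pos_divide_le_eq mult.commute)
qed

lemma exponentially_smooth_mono:
  assumes "exponentially_smooth L f" "L \<le> M"
  shows "exponentially_smooth M f"
proof -
  have L: "L > 0" and g: "\<And>x j. gradient f x $ j > 0"
    using assms(1) by (auto simp: exponentially_smooth_iff)
  have "(\<Sum>j\<in>UNIV. gradient f xbar $ j * ((exp (L * (x - xbar) $ j) - 1) / L))
      \<le> (\<Sum>j\<in>UNIV. gradient f xbar $ j * ((exp (M * (x - xbar) $ j) - 1) / M))" for x xbar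
    using g by (intro sum_mono mult_left_mono exp_chord_slope_mono L assms(2) less_imp_le)
  then show ?thesis
    using assms unfolding exponentially_smooth_iff by (smt (verit))
qed

lemma exponentially_smooth_sum:
  fixes f :: "'i \<Rightarrow> real^'n \<Rightarrow> real"
  assumes f: "\<And>i. i \<in> I \<Longrightarrow> exponentially_smooth L (f i)"
    and nonneg: "\<And>i. i \<in> I \<Longrightarrow> \<alpha> i \<ge> 0"
    and pos: "(\<Sum>i\<in>I. \<alpha> i) > 0"
  shows "exponentially_smooth L (\<lambda>x. \<Sum>i\<in>I. \<alpha> i * f i x)"
proof -
  \<comment> \<open>The sum over an infinite set is \<open>0\<close> by convention.\<close>
  have fin: "finite I"
    using pos by (auto intro: ccontr)
  obtain k where k: "k \<in> I" "\<alpha> k > 0"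
    using pos sum_nonpos[of I \<alpha>] by (meson not_le)
  have C1: "\<And>i. i \<in> I \<Longrightarrow> C1_fun (f i)"
    and grad_pos: "\<And>i x j. i \<in> I \<Longrightarrow> gradient (f i) x $ j > 0"
    using f by (auto simp: exponentially_smooth_iff)
  have gradj: "gradient (\<lambda>x. \<Sum>i\<in>I. \<alpha> i * f i x) x $ j = (\<Sum>i\<in>I. \<alpha> i * gradient (f i) x $ j)"
    for x j
    by (simp add: C1_fun_sum_scale(2)[OF C1])
  have "gradient (\<lambda>x. \<Sum>i\<in>I. \<alpha> i * f i x) x $ j > 0" for x j
    unfolding gradj using k nonneg grad_pos fin
    by (intro sum_pos2[where i = k]) (simp_all add: less_imp_le)
  moreover have "(\<Sum>i\<in>I. \<alpha> i * f i x) \<le> (\<Sum>i\<in>I. \<alpha> i * f i xbar)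
      + (\<Sum>j\<in>UNIV. gradient (\<lambda>x. \<Sum>i\<in>I. \<alpha> i * f i x) xbar $ j
           * ((exp (L * (x - xbar) $ j) - 1) / L))" for x xbar
  proof -
    define c where "c j = (exp (L * (x - xbar) $ j) - 1) / L" for j
    have "(\<Sum>i\<in>I. \<alpha> i * f i x)
        \<le> (\<Sum>i\<in>I. \<alpha> i * (f i xbar + (\<Sum>j\<in>UNIV. gradient (f i) xbar $ j * c j)))"
    proof (intro sum_mono mult_left_mono nonneg)
      fix i assume "i \<in> I"
      then show "f i x \<le> f i xbar + (\<Sum>j\<in>UNIV. gradient (f i) xbar $ j * c j)"
        using f unfolding exponentially_smooth_iff c_def by blast
    qed
    also have "\<dots> = (\<Sum>i\<in>I. \<alpha> i * f i xbar)
        + (\<Sum>i\<in>I. \<Sum>j\<in>UNIV. \<alpha> i * gradient (f i) xbar $ j * c j)"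
      by (simp add: distrib_left sum.distrib sum_distrib_left mult.assoc)
    also have "(\<Sum>i\<in>I. \<Sum>j\<in>UNIV. \<alpha> i * gradient (f i) xbar $ j * c j)
        = (\<Sum>j\<in>UNIV. gradient (\<lambda>x. \<Sum>i\<in>I. \<alpha> i * f i x) xbar $ j * c j)"
      unfolding gradj sum_distrib_right by (rule sum.swap)
    finally show ?thesis
      unfolding c_def .
  qed
  moreover have "L > 0"
    using f[OF k(1)] by (simp add: exponentially_smooth_iff)
  ultimately show ?thesis
    unfolding exponentially_smooth_iff by (intro conjI allI C1_fun_sum_scale(1) C1)
qed

lemma convex_cone_exponentially_smooth:
  "convex_cone_of_functions {f :: real^'n \<Rightarrow> real. exponentially_smooth L f}"
  unfolding convex_cone_of_functions_def
proof (intro conjI ballI allI impI; unfold mem_Collect_eq)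
  fix f g :: "real^'n \<Rightarrow> real"
  assume "exponentially_smooth L f" "exponentially_smooth L g"
  then show "exponentially_smooth L (\<lambda>x. f x + g x)"
    using exponentially_smooth_sum[of UNIV L "\<lambda>b. if b then f else g" "\<lambda>_. 1"]
    by (simp add: UNIV_bool add.commute)
next
  fix c :: real and f :: "real^'n \<Rightarrow> real"
  assume "c > 0" "exponentially_smooth L f"
  then show "exponentially_smooth L (\<lambda>x. c * f x)"
    using exponentially_smooth_sum[of "{()}" L "\<lambda>_. f" "\<lambda>_. c"] by simp
qed

theorem proposition4p12:
  shows "(\<forall>(m::nat) (f :: nat \<Rightarrow> real^'n \<Rightarrow> real) (L :: nat \<Rightarrow> real) (\<alpha> :: nat \<Rightarrow> real).
            (\<forall>i\<in>{1..m}. exponentially_smooth (L i) (f i)) \<longrightarrow>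
            (\<forall>i\<in>{1..m}. \<alpha> i \<ge> 0) \<longrightarrow>
            (\<Sum>i\<in>{1..m}. \<alpha> i) > 0 \<longrightarrow>
            exponentially_smooth (Max (L ` {1..m})) (\<lambda>x. \<Sum>i\<in>{1..m}. \<alpha> i * f i x))
       \<and> (\<forall>L>0. convex_cone_of_functions {f :: real^'n \<Rightarrow> real. exponentially_smooth L f})"
proof (intro conjI allI impI)
  fix m :: nat and f :: "nat \<Rightarrow> real^'n \<Rightarrow> real" and L \<alpha> :: "nat \<Rightarrow> real"
  assume "\<forall>i\<in>{1..m}. exponentially_smooth (L i) (f i)"
    and nonneg: "\<forall>i\<in>{1..m}. \<alpha> i \<ge> 0" and pos: "(\<Sum>i\<in>{1..m}. \<alpha> i) > 0"
  then have "exponentially_smooth (Max (L ` {1..m})) (f i)" if "i \<in> {1..m}" for i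
    using that by (rule_tac exponentially_smooth_mono[where L = "L i"]) auto
  then show "exponentially_smooth (Max (L ` {1..m})) (\<lambda>x. \<Sum>i\<in>{1..m}. \<alpha> i * f i x)"
    using nonneg pos by (intro exponentially_smooth_sum) auto
qed (rule convex_cone_exponentially_smooth)

end
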